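(* The following assertions are true. (i) $I(G_{2,4};x)$ is unimodal; moreover $I(G_{2,4};x)=I(3K_1\amalg K_2\amalg(K_4\ominus K_3);x)$. (ii) Let $H$ be a graph disjoint from the other graphs involved and $w\in V(H)$. Let $G=(G_{2,4};v_4)\ominus(H;w)$, and let $L=3K_1\amalg K_2\amalg\big((K_4\ominus K_3)\ominus H\big)$, where $K_4\ominus K_3$ is joined to $H$ by an edge $vw$, with $v$ a vertex of the $K_3$ that is not an endpoint of the edge joining $K_4$ and $K_3$. Then $I(G;x)=I(L;x)$. If, in addition, $w$ is simplicial in $H$ and $H$ is claw-free, then $I(G;x)$ is unimodal. (iii) Let $H_1,H_2$ be graphs, disjoint from each other and from the other graphs involved, and let $w_1\in V(H_1)$, $w_2\in V(H_2)$. Let $G$ be the graph obtained from the disjoint union $H_1\amalg G_{2,4}\amalg H_2$ by adding the edges $w_1v_4$ and $b_2w_2$. Let $L=3K_1\amalg K_2\amalg L'$, where $L'$ is obtained from the disjoint union $H_1\amalg(K_4\ominus K_3)\amalg H_2$ by adding the edges $w_1v$ and $uw_2$, where $v$ is a vertex of the $K_3$, $u$ is a vertex of the $K_4$, and neither $u$ nor $v$ is an endpoint of the edge joining $K_4$ and $K_3$. Then $I(G;x)=I(L;x)$. If, in addition, $w_1,w_2$ are simplicial in $H_1,H_2$, respectively, and $H_1,H_2$ are claw-free, then $I(G;x)$ is unimodal.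
   Context: All graphs are finite, undirected, without loops or multiple edges. A stable set of a graph $G$ is a set of pairwise non-adjacent vertices; $\alpha(G)$ is the maximum size of a stable set. If $s_k$ is the number of stable sets of size $k$ in $G$ (with $s_0=1$), the independence polynomial of $G$ is $I(G;x)=\sum_{k=0}^{\alpha(G)}s_kx^k$. A polynomial with non-negative real coefficients $a_0,\dots,a_N$ is unimodal if there is $k\in\{0,\dots,N\}$ with $a_0\le\dots\le a_k\ge a_{k+1}\ge\dots\ge a_N$. $G_1\amalg G_2$ is the disjoint union of graphs, $nG$ denotes the disjoint union of $n$ copies of $G$, and $K_n$ is the complete graph on $n$ vertices. For disjoint graphs $G_1,G_2$ and vertices $v_i\in V(G_i)$, the edge-join $(G_1;v_1)\ominus(G_2;v_2)$ is obtained from $G_1\amalg G_2$ by adding the edge $v_1v_2$; one writes $G_1\ominus G_2$ when the vertices are not specified. In particular $K_4\ominus K_3$ is the graph obtained from disjoint copies of $K_4$ and $K_3$ by adding one edge between a vertex of $K_4$ and a vertex of $K_3$. A vertex is simplicial if its neighborhood induces a complete graph. A graph is claw-free if it has no induced subgraph isomorphic to $K_{1,3}$. $G_{2,4}$ is the tree on the 12 vertices $a_1,a_2,b_1,b_2,u_1,u_2,u_3,u_4,v_1,v_2,v_3,v_4$ with edges $a_1b_1,\ a_2b_2,\ b_1b_2$; $u_iv_i$ ($1\le i\le 4$); $v_1v_2,\ v_2v_3,\ v_3v_4$; and $b_2v_2$. *)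

theory Defs
  imports Complex_Main "HOL-Computational_Algebra.Polynomial"
begin

record 'a sgraph =
  verts :: "'a set"
  edges :: "'a set set"

definition sgraph :: "'a sgraph \<Rightarrow> bool" where
  "sgraph G \<longleftrightarrow> finite (verts G) \<and> (\<forall>e\<in>edges G. e \<subseteq> verts G \<and> card e = 2)"

definition adj :: "'a sgraph \<Rightarrow> 'a \<Rightarrow> 'a \<Rightarrow> bool" where
  "adj G x y \<longleftrightarrow> {x, y} \<in> edges G"

definition nbhd :: "'a sgraph \<Rightarrow> 'a \<Rightarrow> 'a set" where
  "nbhd G v = {u \<in> verts G. adj G v u}"

definition induced :: "'a sgraph \<Rightarrow> 'a set \<Rightarrow> 'a sgraph" where
  "induced G W = \<lparr>verts = W, edges = {e \<in> edges G. e \<subseteq> W}\<rparr>"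

definition graph_iso :: "'a sgraph \<Rightarrow> 'b sgraph \<Rightarrow> bool" where
  "graph_iso G H \<longleftrightarrow> (\<exists>f. bij_betw f (verts G) (verts H) \<and>
     (\<forall>x\<in>verts G. \<forall>y\<in>verts G. adj G x y \<longleftrightarrow> adj H (f x) (f y)))"

definition is_complete :: "'a sgraph \<Rightarrow> bool" where
  "is_complete G \<longleftrightarrow> (\<forall>x\<in>verts G. \<forall>y\<in>verts G. x \<noteq> y \<longrightarrow> adj G x y)"

definition simplicial :: "'a sgraph \<Rightarrow> 'a \<Rightarrow> bool" where
  "simplicial G v \<longleftrightarrow> v \<in> verts G \<and> is_complete (induced G (nbhd G v))"

definition K :: "nat \<Rightarrow> nat sgraph" where
  "K n = \<lparr>verts = {..<n}, edges = {{i, j} | i j. i < n \<and> j < n \<and> i \<noteq> j}\<rparr>"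

definition claw :: "nat sgraph" where
  "claw = \<lparr>verts = {..<4}, edges = {{0, 1}, {0, 2}, {0, 3}}\<rparr>"

definition claw_free :: "'a sgraph \<Rightarrow> bool" where
  "claw_free G \<longleftrightarrow> \<not> (\<exists>W \<subseteq> verts G. graph_iso (induced G W) claw)"

text \<open>Disjointness of the graphs being combined is enforced by tagging their vertices:
  sum types for disjoint unions and edge-joins, an index for repeated copies.\<close>

definition disj_union :: "'a sgraph \<Rightarrow> 'b sgraph \<Rightarrow> ('a + 'b) sgraph"  (infixr \<open>\<amalg>\<close> 65) where
  "G \<amalg> H = \<lparr>verts = Inl ` verts G \<union> Inr ` verts H,
            edges = (\<lambda>e. Inl ` e) ` edges G \<union> (\<lambda>e. Inr ` e) ` edges H\<rparr>"

definition copies :: "nat \<Rightarrow> 'a sgraph \<Rightarrow> (nat \<times> 'a) sgraph" where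
  "copies n G = \<lparr>verts = {..<n} \<times> verts G,
                 edges = (\<Union>i<n. (\<lambda>e. Pair i ` e) ` edges G)\<rparr>"

definition add_edge :: "'a sgraph \<Rightarrow> 'a \<Rightarrow> 'a \<Rightarrow> 'a sgraph" where
  "add_edge G x y = \<lparr>verts = verts G, edges = insert {x, y} (edges G)\<rparr>"

definition edge_join :: "'a sgraph \<Rightarrow> 'a \<Rightarrow> 'b sgraph \<Rightarrow> 'b \<Rightarrow> ('a + 'b) sgraph" where
  "edge_join G v H w = add_edge (G \<amalg> H) (Inl v) (Inr w)"

datatype g24_vertex = a1 | a2 | b1 | b2 | u1 | u2 | u3 | u4 | v1 | v2 | v3 | v4

definition G24 :: "g24_vertex sgraph" where
  "G24 = \<lparr>verts = UNIV,
          edges = {{a1, b1}, {a2, b2}, {b1, b2},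
                   {u1, v1}, {u2, v2}, {u3, v3}, {u4, v4},
                   {v1, v2}, {v2, v3}, {v3, v4},
                   {b2, v2}}\<rparr>"

definition stable_set :: "'a sgraph \<Rightarrow> 'a set \<Rightarrow> bool" where
  "stable_set G S \<longleftrightarrow> S \<subseteq> verts G \<and> (\<forall>x\<in>S. \<forall>y\<in>S. \<not> adj G x y)"

definition stability_number :: "'a sgraph \<Rightarrow> nat" where
  "stability_number G = Max (card ` {S. stable_set G S})"

definition num_stable :: "'a sgraph \<Rightarrow> nat \<Rightarrow> nat" where
  "num_stable G k = card {S. stable_set G S \<and> card S = k}"

definition indep_poly :: "'a sgraph \<Rightarrow> real poly" where
  "indep_poly G = (\<Sum>k\<le>stability_number G. monom (real (num_stable G k)) k)"

text \<open>The coefficient sequence is read up to the degree, so trailing zeros are irrelevant.\<close>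

definition unimodal :: "real poly \<Rightarrow> bool" where
  "unimodal p \<longleftrightarrow> (\<forall>i. 0 \<le> coeff p i) \<and>
     (\<exists>k\<le>degree p. (\<forall>i<k. coeff p i \<le> coeff p (Suc i)) \<and>
                     (\<forall>i\<in>{k..<degree p}. coeff p (Suc i) \<le> coeff p i))"

end

theory Submission
  imports Defs
begin

text \<open>
  The theorem rests on two facts that have nothing to do with each other.

  The first is an identity between two small graphs. For a graph \<open>G\<close> and a set \<open>U\<close> of vertices let
  \<open>stable_gf G U\<close> be the generating function, by size, of the stable sets that contain \<open>U\<close>. Adding
  an edge \<open>xy\<close> removes precisely the stable sets through \<open>x\<close> and \<open>y\<close>, and disjoint unions multiply.
  Hence, when \<open>G\<close> is joined by edges at \<open>v\<close> and \<open>u\<close> to other graphs, the independence polynomial of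
  the result depends on \<open>G\<close> only through \<open>stable_gf G U\<close> for the subsets \<open>U\<close> of \<open>{v, u}\<close>
  (\<open>stable_gf_edge_join\<close>, \<open>stable_gf_two_sided_join\<close>). The tree \<open>G24\<close> with the attaching vertices
  \<open>v4, b2\<close> and the graph \<open>3K\<^sub>1 \<amalg> K\<^sub>2 \<amalg> (K\<^sub>4 \<ominus> K\<^sub>3)\<close> with the attaching vertices \<open>v, u\<close> turn out to have
  the same four generating functions (\<open>stable_gf_G24_K4_K3\<close>): with \<open>c = (1 + x)\<^sup>3 (1 + 2x)\<close> they are
  \<open>c (1 + 7x + 11x\<^sup>2)\<close>, \<open>c x (1 + 4x)\<close>, \<open>c x (1 + 3x)\<close> and \<open>c x\<^sup>2\<close>. So one graph may
  replace the other in every such join.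

  The second is Hamidoune's theorem that the independence polynomial of a claw-free graph is
  log-concave (\<open>num_stable_log_concave\<close>), hence unimodal. The symmetric difference of two stable
  sets \<open>S\<close>, \<open>T\<close> induces a bipartite graph in which every vertex has degree at most two, since three
  neighbours in a stable set would form a claw. Each component of it therefore has parts whose sizes
  differ by at most one, and the pairs with the same intersection and the same symmetric difference
  arise from \<open>(S, T)\<close> by exchanging the parts of components. If \<open>m\<close> components are odd, the sizes of
  the pairs are distributed like the \<open>m\<close>-th row of binomial coefficients, so equal sizes are the most
  frequent.

  The tree \<open>G24\<close> contains claws, but the graph that replaces it is assembled from complete graphs by
  edges between simplicial vertices, and such edges create no claws (\<open>claw_free_add_edge\<close>).
\<close>

section \<open>Generating functions of stable sets\<close>

lemma adj_commute: "adj G x y \<longleftrightarrow> adj G y x"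
  by (simp add: adj_def insert_commute)

lemma adj_add_edge: "adj (add_edge G x y) s t \<longleftrightarrow> adj G s t \<or> {s, t} = {x, y}"
  by (auto simp: adj_def add_edge_def)

lemma adj_disj_union [simp]:
  "adj (G \<amalg> H) (Inl a) (Inl b) \<longleftrightarrow> adj G a b"
  "adj (G \<amalg> H) (Inr c) (Inr d) \<longleftrightarrow> adj H c d"
  "\<not> adj (G \<amalg> H) (Inl a) (Inr d)"
  "\<not> adj (G \<amalg> H) (Inr c) (Inl b)"
proof -
  have Inl_image: "{Inl a, Inl b} = Inl ` e \<longleftrightarrow> e = {a, b}" for e :: "'a set"
    using inj_image_eq_iff[OF inj_Inl, of e "{a, b}"] by (simp add: eq_commute)
  have Inl_not_Inr: "{Inl a, Inl b} \<noteq> Inr ` e" and Inr_not_Inl: "{Inr c, Inr d} \<noteq> Inl ` e'"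
    for e :: "'b set" and e' :: "'a set"
    by blast+
  have Inr_image: "{Inr c, Inr d} = Inr ` e \<longleftrightarrow> e = {c, d}" for e :: "'b set"
    using inj_image_eq_iff[OF inj_Inr, of e "{c, d}"] by (simp add: eq_commute)
  show "adj (G \<amalg> H) (Inl a) (Inl b) \<longleftrightarrow> adj G a b"
    by (simp add: adj_def disj_union_def image_iff Inl_image Inl_not_Inr)
  show "adj (G \<amalg> H) (Inr c) (Inr d) \<longleftrightarrow> adj H c d"
    by (simp add: adj_def disj_union_def image_iff Inr_image Inr_not_Inl)
qed (auto simp: adj_def disj_union_def)

lemma adj_K [simp]: "adj (K n) i j \<longleftrightarrow> i < n \<and> j < n \<and> i \<noteq> j"
  by (auto simp: adj_def K_def doubleton_eq_iff)

lemma verts_simps [simp]: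
  "verts (add_edge G x y) = verts G"
  "verts (G \<amalg> H) = Inl ` verts G \<union> Inr ` verts H"
  "verts (K n) = {..<n}"
  "verts (copies n G) = {..<n} \<times> verts G"
  by (simp_all add: add_edge_def disj_union_def K_def copies_def)

lemma edges_copies_K1 [simp]: "edges (copies n (K 1)) = {}"
  by (auto simp: copies_def K_def)

text \<open>The independence polynomial restricted to stable sets that contain prescribed vertices. It
  is this refinement, and not the independence polynomial alone, that behaves well under adding
  an edge.\<close>

definition stable_gf :: "'a sgraph \<Rightarrow> 'a set \<Rightarrow> real poly" where
  "stable_gf G U = (\<Sum>S | stable_set G S \<and> U \<subseteq> S. monom 1 (card S))"

lemma finite_stable_sets:
  assumes "finite (verts G)"
  shows "finite {S. stable_set G S \<and> P S}"
  by (rule finite_subset[of _ "Pow (verts G)"]) (use assms in \<open>auto simp: stable_set_def\<close>)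

lemma stable_set_card_le:
  assumes "finite (verts G)" "stable_set G S"
  shows "card S \<le> stability_number G"
  unfolding stability_number_def using finite_stable_sets[OF assms(1), of "\<lambda>_. True"] assms(2)
  by (intro Max_ge) auto

lemma coeff_indep_poly:
  assumes "finite (verts G)"
  shows "coeff (indep_poly G) k = real (num_stable G k)"
proof -
  have "num_stable G k = 0" if "\<not> k \<le> stability_number G"
  proof -
    have "{S. stable_set G S \<and> card S = k} = {}"
      using that stable_set_card_le[OF assms] by auto
    then show ?thesis by (simp only: num_stable_def card.empty)
  qed
  then show ?thesis
    by (auto simp: indep_poly_def coeff_sum)
qed

lemma coeff_sum_monom_card:
  assumes "finite A"
  shows "coeff (\<Sum>S\<in>A. monom 1 (card S)) k = (of_nat (card {S \<in> A. card S = k}) :: real)"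
  using assms by (simp add: coeff_sum sum.If_cases Int_def)

lemma indep_poly_eq_stable_gf:
  assumes "finite (verts G)"
  shows "indep_poly G = stable_gf G {}"
proof (rule poly_eqI)
  show "coeff (indep_poly G) k = coeff (stable_gf G {}) k" for k
    using finite_stable_sets[OF assms, of "\<lambda>_. True"]
    by (simp add: coeff_indep_poly[OF assms] stable_gf_def num_stable_def coeff_sum_monom_card)
qed

text \<open>Adding the edge \<open>xy\<close> destroys exactly the stable sets that contain both \<open>x\<close> and \<open>y\<close>; the
  identity also holds when the edge was there before, since the subtracted term is then \<open>0\<close>.\<close>

lemma stable_gf_add_edge:
  assumes "finite (verts G)"
  shows "stable_gf (add_edge G x y) U = stable_gf G U - stable_gf G (insert x (insert y U))"
proof -
  have stable: "stable_set (add_edge G x y) S \<longleftrightarrow> stable_set G S \<and> \<not> {x, y} \<subseteq> S" for S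
    by (auto simp: stable_set_def adj_add_edge doubleton_eq_iff)
  have split: "{S. stable_set G S \<and> U \<subseteq> S} = {S. stable_set (add_edge G x y) S \<and> U \<subseteq> S} \<union>
      {S. stable_set G S \<and> insert x (insert y U) \<subseteq> S}"
    by (auto simp: stable)
  have "stable_gf G U = stable_gf (add_edge G x y) U + stable_gf G (insert x (insert y U))"
    unfolding stable_gf_def split
    by (rule sum.union_disjoint) (auto simp: stable intro!: finite_stable_sets assms)
  then show ?thesis by simp
qed

lemma stable_gf_disj_union:
  assumes "finite (verts G)" "finite (verts H)"
  shows "stable_gf (G \<amalg> H) U = stable_gf G (Inl -` U) * stable_gf H (Inr -` U)"
proof -
  let ?A = "{S. stable_set G S \<and> Inl -` U \<subseteq> S}" and ?B = "{S. stable_set H S \<and> Inr -` U \<subseteq> S}"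
  have stable: "stable_set (G \<amalg> H) S \<longleftrightarrow> stable_set G (Inl -` S) \<and> stable_set H (Inr -` S)" for S
  proof -
    have ball: "(\<forall>z\<in>S. P z) \<longleftrightarrow> (\<forall>a\<in>Inl -` S. P (Inl a)) \<and> (\<forall>b\<in>Inr -` S. P (Inr b))" for P
      by (auto intro: sum.induct[of "\<lambda>z. z \<in> S \<longrightarrow> P z", rule_format])
    have "S \<subseteq> verts (G \<amalg> H) \<longleftrightarrow> Inl -` S \<subseteq> verts G \<and> Inr -` S \<subseteq> verts H"
      unfolding subset_eq ball by auto
    moreover have "(\<forall>x\<in>S. \<forall>y\<in>S. \<not> adj (G \<amalg> H) x y) \<longleftrightarrow>
      (\<forall>x\<in>Inl -` S. \<forall>y\<in>Inl -` S. \<not> adj G x y) \<and> (\<forall>x\<in>Inr -` S. \<forall>y\<in>Inr -` S. \<not> adj H x y)"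
      unfolding ball by simp
    ultimately show ?thesis by (auto simp: stable_set_def)
  qed
  have plus: "Inl -` (S <+> T) = S" "Inr -` (S <+> T) = T" for S :: "'a set" and T :: "'b set"
    by (auto simp: vimage_def)
  have plus': "(Inl -` S) <+> (Inr -` S) = S" for S :: "('a + 'b) set"
  proof (rule set_eqI)
    show "z \<in> (Inl -` S) <+> (Inr -` S) \<longleftrightarrow> z \<in> S" for z by (cases z) auto
  qed
  have sub: "V \<subseteq> S <+> T \<longleftrightarrow> Inl -` V \<subseteq> S \<and> Inr -` V \<subseteq> T" for V :: "('a + 'b) set" and S T
  proof -
    have "V \<subseteq> S <+> T \<longleftrightarrow> (Inl -` V) <+> (Inr -` V) \<subseteq> S <+> T" by (simp add: plus')
    then show ?thesis by (auto simp: Plus_def)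
  qed
  have fin: "finite S" if "S \<in> ?A" for S
    using that assms(1) by (auto simp: stable_set_def dest: finite_subset)
  have fin': "finite S" if "S \<in> ?B" for S
    using that assms(2) by (auto simp: stable_set_def dest: finite_subset)
  have "stable_gf G (Inl -` U) * stable_gf H (Inr -` U) =
      (\<Sum>(S, T)\<in>?A \<times> ?B. monom 1 (card S) * monom 1 (card T))"
    by (simp add: stable_gf_def sum_product sum.cartesian_product)
  also have "\<dots> = (\<Sum>S | stable_set (G \<amalg> H) S \<and> U \<subseteq> S. monom 1 (card S))"
  proof (rule sum.reindex_bij_witness[where j = "\<lambda>(S, T). S <+> T" and i = "\<lambda>S. (Inl -` S, Inr -` S)"])
    fix p assume p: "p \<in> ?A \<times> ?B"
    obtain S T where [simp]: "p = (S, T)" by (cases p)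
    show "(case p of (S, T) \<Rightarrow> S <+> T) \<in> {S. stable_set (G \<amalg> H) S \<and> U \<subseteq> S}"
      using p by (simp add: stable plus sub)
    show "monom 1 (card (case p of (S, T) \<Rightarrow> S <+> T)) =
        ((case p of (S, T) \<Rightarrow> monom 1 (card S) * monom 1 (card T)) :: real poly)"
      using p by (simp add: card_Plus fin fin' mult_monom)
    show "(Inl -` (case p of (S, T) \<Rightarrow> S <+> T), Inr -` (case p of (S, T) \<Rightarrow> S <+> T)) = p"
      by (simp add: plus)
  next
    fix S assume S: "S \<in> {S. stable_set (G \<amalg> H) S \<and> U \<subseteq> S}"
    then show "(Inl -` S, Inr -` S) \<in> ?A \<times> ?B"
      by (simp add: stable vimage_mono)
    show "(case (Inl -` S, Inr -` S) of (S, T) \<Rightarrow> S <+> T) = S"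
      by (simp add: plus')
  qed
  finally show ?thesis by (simp add: stable_gf_def)
qed

lemma stable_gf_iso:
  assumes f: "bij_betw f (verts G) (verts H)"
    and adj: "\<And>x y. x \<in> verts G \<Longrightarrow> y \<in> verts G \<Longrightarrow> adj H (f x) (f y) \<longleftrightarrow> adj G x y"
    and U: "U \<subseteq> verts G"
  shows "stable_gf G U = stable_gf H (f ` U)"
proof -
  define g where "g = inv_into (verts G) f"
  have inj: "inj_on f (verts G)" and img: "f ` verts G = verts H"
    using f by (auto simp: bij_betw_def)
  have stable: "stable_set H (f ` S) \<longleftrightarrow> stable_set G S" if "S \<subseteq> verts G" for S
    using that adj img by (auto simp: stable_set_def) blast+
  have gf: "g ` f ` S = S" if "S \<subseteq> verts G" for S
    using inj that by (simp add: g_def inv_into_image_cancel)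
  have fg: "f ` g ` T = T" if "T \<subseteq> verts H" for T
    using img that by (simp add: g_def image_inv_into_cancel)
  have gV: "g ` T \<subseteq> verts G" if "T \<subseteq> verts H" for T
    using img that inv_into_into[of _ f "verts G"] by (fastforce simp: g_def)
  have V: "S \<subseteq> verts G" if "stable_set G S" for G :: "'x sgraph" and S
    using that by (simp add: stable_set_def)
  show ?thesis
    unfolding stable_gf_def
  proof (rule sum.reindex_bij_witness[where j = "image f" and i = "image g"])
    fix S assume S: "S \<in> {S. stable_set G S \<and> U \<subseteq> S}"
    then have SV: "S \<subseteq> verts G" by (simp add: V)
    show "g ` f ` S = S" using gf SV .
    show "f ` S \<in> {S. stable_set H S \<and> f ` U \<subseteq> S}" using S SV stable by auto
    show "monom 1 (card (f ` S)) = (monom 1 (card S) :: real poly)"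
      using inj SV by (metis card_image inj_on_subset)
  next
    fix T assume T: "T \<in> {S. stable_set H S \<and> f ` U \<subseteq> S}"
    then have TV: "T \<subseteq> verts H" by (simp add: V)
    show "f ` g ` T = T" using fg TV .
    show "g ` T \<in> {S. stable_set G S \<and> U \<subseteq> S}"
      using T TV stable[OF gV[OF TV]] fg[OF TV] gf[OF U] image_mono[of "f ` U" T g] by auto
  qed
qed

lemma stable_gf_K:
  "stable_gf (K n) {} = 1 + of_nat n * monom 1 1"
  "i < n \<Longrightarrow> stable_gf (K n) {i} = monom 1 1"
  "i \<noteq> j \<Longrightarrow> stable_gf (K n) (insert i (insert j U)) = 0"
proof -
  have stable: "stable_set (K n) S \<longleftrightarrow> S = {} \<or> (\<exists>i<n. S = {i})" for S
  proof
    assume S: "stable_set (K n) S"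
    show "S = {} \<or> (\<exists>i<n. S = {i})"
    proof (cases "S = {}")
      case False
      then obtain i where "i \<in> S" by blast
      with S have "i < n" "S = {i}" by (auto simp: stable_set_def subset_iff)
      then show ?thesis by blast
    qed simp
  qed (auto simp: stable_set_def)
  have "{S. stable_set (K n) S} = insert {} ((\<lambda>i. {i}) ` {..<n})"
    by (auto simp: stable)
  then show "stable_gf (K n) {} = 1 + of_nat n * monom 1 1"
    by (auto simp: stable_gf_def sum.insert sum.reindex monom_0 image_iff)
  show "stable_gf (K n) {i} = monom 1 1" if "i < n"
  proof -
    have "{S. stable_set (K n) S \<and> {i} \<subseteq> S} = {{i}}"
      using that by (auto simp: stable)
    then show ?thesis by (simp add: stable_gf_def del: singleton_insert_inj_eq)
  qed
  show "stable_gf (K n) (insert i (insert j U)) = 0" if "i \<noteq> j"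
    using that by (auto simp: stable_gf_def stable intro!: sum.neutral)
qed

text \<open>Without edges every set of vertices is stable, so this is the binomial theorem.\<close>

lemma stable_gf_edgeless:
  assumes "edges G = {}" "finite (verts G)"
  shows "stable_gf G {} = (1 + monom 1 1) ^ card (verts G)"
proof -
  have "(1 + monom 1 1) ^ card (verts G) = (\<Prod>v\<in>verts G. monom 1 1 + 1 :: real poly)"
    by (simp add: add.commute)
  also have "\<dots> = (\<Sum>S\<in>Pow (verts G). (\<Prod>v\<in>S. monom 1 1) * (\<Prod>v\<in>verts G - S. 1))"
    by (rule prod_add) (rule assms)
  also have "\<dots> = (\<Sum>S | stable_set G S. monom 1 (card S))"
    using assms(1) by (intro sum.cong) (auto simp: stable_set_def adj_def monom_power)
  finally show ?thesis by (simp add: stable_gf_def)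
qed

section \<open>Claw-free graphs and simplicial vertices\<close>

lemma sgraphD:
  assumes "sgraph G" "adj G x y"
  shows "x \<in> verts G" "y \<in> verts G" "x \<noteq> y"
proof -
  have "{x, y} \<subseteq> verts G \<and> card {x, y} = 2"
    using assms by (simp only: sgraph_def adj_def)
  then show "x \<in> verts G" "y \<in> verts G" "x \<noteq> y"
    by auto
qed

lemma sgraph_add_edge:
  assumes "sgraph G" "x \<in> verts G" "y \<in> verts G" "x \<noteq> y"
  shows "sgraph (add_edge G x y)"
  using assms by (auto simp: sgraph_def add_edge_def)

lemma sgraph_disj_union:
  assumes "sgraph G" "sgraph H"
  shows "sgraph (G \<amalg> H)"
proof -
  have e: "Inl ` e \<subseteq> verts (G \<amalg> H) \<and> card (Inl ` e :: ('a + 'b) set) = 2" if "e \<in> edges G" for e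
    using that assms(1) by (auto simp: sgraph_def card_image)
  have e': "Inr ` e \<subseteq> verts (G \<amalg> H) \<and> card (Inr ` e :: ('a + 'b) set) = 2" if "e \<in> edges H" for e
    using that assms(2) by (auto simp: sgraph_def card_image)
  have edges: "edges (G \<amalg> H) = (\<lambda>e. Inl ` e) ` edges G \<union> (\<lambda>e. Inr ` e) ` edges H"
    by (simp add: disj_union_def)
  have "finite (verts (G \<amalg> H))"
    using assms by (simp add: sgraph_def)
  then show ?thesis
    unfolding sgraph_def edges ball_Un ball_simps using e e' by blast
qed

lemma sgraph_K: "sgraph (K n)"
  by (auto simp: sgraph_def K_def)

lemma sgraph_copies_K1: "sgraph (copies n (K 1))"
  unfolding sgraph_def edges_copies_K1 by simp

lemma adj_induced: "adj (induced G W) a b \<longleftrightarrow> adj G a b \<and> a \<in> W \<and> b \<in> W"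
  by (auto simp: adj_def induced_def)

lemma verts_induced: "verts (induced G W) = W"
  by (simp add: induced_def)

lemma adj_claw: "adj claw i j \<longleftrightarrow> i = 0 \<and> j \<in> {1, 2, 3} \<or> j = 0 \<and> i \<in> {1, 2, 3}"
  by (auto simp: adj_def claw_def doubleton_eq_iff)

lemma claw_free_iff:
  assumes "sgraph G"
  shows "claw_free G \<longleftrightarrow> (\<forall>c x y z. adj G c x \<and> adj G c y \<and> adj G c z \<and>
    x \<noteq> y \<and> x \<noteq> z \<and> y \<noteq> z \<longrightarrow> adj G x y \<or> adj G x z \<or> adj G y z)"
    (is "_ \<longleftrightarrow> ?R")
proof
  assume cf: "claw_free G"
  show ?R
  proof (intro allI impI, elim conjE, rule ccontr)
    fix c x y z
    assume *: "adj G c x" "adj G c y" "adj G c z" "x \<noteq> y" "x \<noteq> z" "y \<noteq> z"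
      "\<not> (adj G x y \<or> adj G x z \<or> adj G y z)"
    note V = sgraphD[OF assms *(1)] sgraphD[OF assms *(2)] sgraphD[OF assms *(3)]
    have irrefl: "\<not> adj G a a" for a
      using sgraphD(3)[OF assms] by blast
    define f :: "'a \<Rightarrow> nat" where "f a = (if a = c then 0 else if a = x then 1 else if a = y then 2 else 3)" for a
    have fv: "f c = 0" "f x = 1" "f y = 2" "f z = 3"
      using V * by (simp_all add: f_def)
    have claw_verts: "verts claw = {0, 1, 2, 3}"
      by (auto simp: claw_def)
    have "bij_betw f {c, x, y, z} (verts claw)"
      by (simp add: bij_betw_def inj_on_def fv claw_verts)
    moreover have "adj (induced G {c, x, y, z}) a b \<longleftrightarrow> adj claw (f a) (f b)"
      if "a \<in> {c, x, y, z}" "b \<in> {c, x, y, z}" for a b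
    proof -
      have "adj G x c" "adj G y c" "adj G z c" "\<not> adj G y x" "\<not> adj G z x" "\<not> adj G z y"
        using * by (simp_all add: adj_commute[of G x c] adj_commute[of G y c] adj_commute[of G z c]
            adj_commute[of G y x] adj_commute[of G z x] adj_commute[of G z y])
      with that * show ?thesis
        by (elim insertE emptyE) (simp_all add: fv adj_induced adj_claw irrefl)
    qed
    ultimately have "graph_iso (induced G {c, x, y, z}) claw"
      unfolding graph_iso_def verts_induced by (intro exI[of _ f]) simp
    moreover have "{c, x, y, z} \<subseteq> verts G"
      using V by simp
    ultimately show False
      using cf unfolding claw_free_def by (meson)
  qed
next
  assume R: ?R
  show "claw_free G"
    unfolding claw_free_def
  proof (intro notI, elim exE conjE)
    fix W assume "W \<subseteq> verts G" "graph_iso (induced G W) claw"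
    then obtain f where f: "bij_betw f W {..<4}"
      and adj: "\<And>a b. a \<in> W \<Longrightarrow> b \<in> W \<Longrightarrow> adj (induced G W) a b \<longleftrightarrow> adj claw (f a) (f b)"
      by (auto simp: graph_iso_def verts_induced claw_def)
    have ex: "\<exists>a\<in>W. f a = i" if "i < 4" for i
      using f that by (metis bij_betw_imp_surj_on imageE lessThan_iff)
    obtain c x y z where V: "c \<in> W" "x \<in> W" "y \<in> W" "z \<in> W"
      and fs: "f c = 0" "f x = 1" "f y = 2" "f z = 3"
      using ex[of 0] ex[of 1] ex[of 2] ex[of 3] by auto
    have adj': "adj G a b \<longleftrightarrow> adj claw (f a) (f b)" if "a \<in> W" "b \<in> W" for a b
      using adj[OF that] that by (simp add: adj_induced)
    have "adj G c x" "adj G c y" "adj G c z" "x \<noteq> y" "x \<noteq> z" "y \<noteq> z"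
      "\<not> adj G x y" "\<not> adj G x z" "\<not> adj G y z"
      using V fs by (auto simp: adj' adj_claw)
    with R show False by blast
  qed
qed

lemma simplicial_iff:
  assumes "sgraph G"
  shows "simplicial G v \<longleftrightarrow> v \<in> verts G \<and>
    (\<forall>x y. adj G v x \<and> adj G v y \<and> x \<noteq> y \<longrightarrow> adj G x y)"
  by (auto simp: simplicial_def is_complete_def verts_induced adj_induced nbhd_def
      dest: sgraphD(2)[OF assms])

lemma simplicial_add_edge:
  assumes "sgraph G" "simplicial G v" "v \<noteq> x" "v \<noteq> y" "x \<in> verts G" "y \<in> verts G" "x \<noteq> y"
  shows "simplicial (add_edge G x y) v"
  using assms(2-4)
  unfolding simplicial_iff[OF sgraph_add_edge[OF assms(1,5-7)]] simplicial_iff[OF assms(1)]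
    adj_add_edge doubleton_eq_iff verts_simps by blast

text \<open>An edge \<open>xy\<close> between simplicial vertices creates no claw: a new claw would have its centre at
  \<open>x\<close> or \<open>y\<close>, at most one of its leaves would be the other endpoint, and the remaining two leaves
  would be old neighbours of a simplicial vertex, hence adjacent. Centres other than \<open>x\<close> and \<open>y\<close>
  keep their neighbourhoods.\<close>

lemma claw_free_add_edge:
  assumes "sgraph G" "claw_free G" "simplicial G x" "simplicial G y" "x \<noteq> y"
  shows "claw_free (add_edge G x y)"
proof -
  have xy: "x \<in> verts G" "y \<in> verts G"
    using assms by (auto simp: simplicial_def)
  have G': "sgraph (add_edge G x y)"
    by (intro sgraph_add_edge assms xy)
  have "adj (add_edge G x y) s t \<or> adj (add_edge G x y) s u \<or> adj (add_edge G x y) t u"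
    if nb: "adj (add_edge G x y) c s" "adj (add_edge G x y) c t" "adj (add_edge G x y) c u"
      and ne: "s \<noteq> t" "s \<noteq> u" "t \<noteq> u" for c s t u
  proof -
    have "adj G s t \<or> adj G s u \<or> adj G t u"
    proof (cases "c = x \<or> c = y")
      case True
      \<comment> \<open>\<open>d\<close> is the other endpoint of the new edge.\<close>
      then obtain d where nbc: "\<And>r. adj (add_edge G x y) c r \<Longrightarrow> adj G c r \<or> r = d"
        using \<open>x \<noteq> y\<close> by (auto simp: adj_add_edge doubleton_eq_iff)
      have "simplicial G c" using True assms by blast
      then have clique: "adj G q r" if "adj G c q" "adj G c r" "q \<noteq> r" for q r
        using that unfolding simplicial_iff[OF assms(1)] by blast
      show ?thesis
        using nbc[OF nb(1)] nbc[OF nb(2)] nbc[OF nb(3)] ne clique by blast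
    next
      case False
      then have "adj G c s" "adj G c t" "adj G c u"
        using nb by (auto simp: adj_add_edge doubleton_eq_iff)
      with ne assms(2) show ?thesis
        unfolding claw_free_iff[OF assms(1)] by blast
    qed
    then show ?thesis by (auto simp: adj_add_edge)
  qed
  then show ?thesis
    unfolding claw_free_iff[OF G'] by blast
qed

lemma simplicial_disj_union:
  assumes "sgraph G" "sgraph H"
  shows "simplicial (G \<amalg> H) (Inl v) \<longleftrightarrow> simplicial G v"
    and "simplicial (G \<amalg> H) (Inr w) \<longleftrightarrow> simplicial H w"
  unfolding simplicial_iff[OF sgraph_disj_union[OF assms]] simplicial_iff[OF assms(1)]
    simplicial_iff[OF assms(2)] split_sum_all by auto

lemma claw_free_disj_union:
  assumes "sgraph G" "sgraph H" "claw_free G" "claw_free H"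
  shows "claw_free (G \<amalg> H)"
  using assms(3,4)
  unfolding claw_free_iff[OF sgraph_disj_union[OF assms(1,2)]] claw_free_iff[OF assms(1)]
    claw_free_iff[OF assms(2)] split_sum_all by simp

lemma simplicial_K: "i < n \<Longrightarrow> simplicial (K n) i"
  by (simp add: simplicial_iff sgraph_K)

lemma claw_free_K: "claw_free (K n)"
  by (auto simp: claw_free_iff sgraph_K)

lemma claw_free_copies_K1: "claw_free (copies n (K 1))"
  unfolding claw_free_iff[OF sgraph_copies_K1] adj_def edges_copies_K1 by simp

section \<open>Log-concavity for claw-free graphs\<close>

lemma claw_free_nbhd_stable:
  assumes "sgraph G" "claw_free G" "stable_set G S"
  shows "card {y \<in> S. adj G c y} \<le> 2"
proof (rule ccontr)
  assume "\<not> ?thesis"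
  then obtain N where N: "N \<subseteq> {y \<in> S. adj G c y}" "card N = 3"
    using obtain_subset_with_card_n[of 3 "{y \<in> S. adj G c y}"] by auto
  then obtain x y z where "N = {x, y, z}" "x \<noteq> y" "x \<noteq> z" "y \<noteq> z"
    by (auto simp: card_3_iff)
  moreover from this N have "\<not> adj G x y" "\<not> adj G x z" "\<not> adj G y z"
    using assms(3) by (auto simp: stable_set_def)
  ultimately show False
    using N(1) assms(2) unfolding claw_free_iff[OF assms(1)] by blast
qed

text \<open>The next two notions describe unions of connected components and connectedness inside the
  subgraph induced by a vertex set. Connectedness is minimality among nonempty sets closed under
  adjacency: a component is then obtained by choosing a smallest closed set, and the two facts
  needed about components follow by exhibiting closed subsets, without any reference to paths.\<close>

definition adj_closed :: "'a sgraph \<Rightarrow> 'a set \<Rightarrow> 'a set \<Rightarrow> bool" where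
  "adj_closed G D C \<longleftrightarrow> C \<subseteq> D \<and> (\<forall>x\<in>C. \<forall>y\<in>D. adj G x y \<longrightarrow> y \<in> C)"

definition connected_set :: "'a sgraph \<Rightarrow> 'a set \<Rightarrow> bool" where
  "connected_set G C \<longleftrightarrow> C \<noteq> {} \<and> (\<forall>A. adj_closed G C A \<longrightarrow> A = {} \<or> A = C)"

lemma obtain_component:
  assumes "finite D" "D \<noteq> {}"
  obtains C where "adj_closed G D C" "connected_set G C"
proof -
  have "adj_closed G D D" by (simp add: adj_closed_def)
  with assms obtain C where C: "adj_closed G D C \<and> C \<noteq> {}"
    and min: "\<And>A. adj_closed G D A \<and> A \<noteq> {} \<Longrightarrow> card C \<le> card A"
    using ex_has_least_nat[of "\<lambda>A. adj_closed G D A \<and> A \<noteq> {}" D card] by blast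
  have "finite C"
    using C assms(1) by (auto simp: adj_closed_def dest: finite_subset)
  have "A = C" if "adj_closed G C A" "A \<noteq> {}" for A
  proof -
    have "adj_closed G D A"
      using C that(1) unfolding adj_closed_def by blast
    with min that(2) have "card C \<le> card A" by blast
    moreover have "A \<subseteq> C" using that by (simp add: adj_closed_def)
    ultimately show "A = C" using \<open>finite C\<close> by (simp add: card_seteq)
  qed
  with C have "connected_set G C" unfolding connected_set_def by blast
  with C that show thesis by blast
qed

text \<open>A bipartition is recorded by its first part only. The parts are ordered: \<open>X\<close> and \<open>D - X\<close>
  count separately.\<close>

definition bipartitions :: "'a sgraph \<Rightarrow> 'a set \<Rightarrow> 'a set set" where
  "bipartitions G D = {X. X \<subseteq> D \<and> stable_set G X \<and> stable_set G (D - X)}"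

definition bipartition_gf :: "'a sgraph \<Rightarrow> 'a set \<Rightarrow> real poly" where
  "bipartition_gf G D = (\<Sum>X\<in>bipartitions G D. monom 1 (card X))"

lemma finite_bipartitions: "finite D \<Longrightarrow> finite (bipartitions G D)"
  by (rule finite_subset[of _ "Pow D"]) (auto simp: bipartitions_def)

lemma coeff_bipartition_gf:
  "finite D \<Longrightarrow> coeff (bipartition_gf G D) k = real (card {X \<in> bipartitions G D. card X = k})"
  by (simp add: bipartition_gf_def coeff_sum_monom_card finite_bipartitions)

text \<open>A connected graph on \<open>n\<close> vertices has at least \<open>n - 1\<close> edges. The proof takes a largest set
  \<open>A\<close> that spans at least \<open>card A - 1\<close> edges. If \<open>A\<close> were not closed under adjacency, it could be
  enlarged by the end of an edge that leaves it, so \<open>A\<close> is everything. An edge is counted as a pair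
  whose first entry is in \<open>X\<close>, so that no edge is counted twice.\<close>

lemma connected_set_card_edges:
  assumes "finite C" "connected_set G C" "C = X \<union> Y" "X \<inter> Y = {}" "stable_set G X" "stable_set G Y"
  shows "card C \<le> card {(x, y). x \<in> X \<and> y \<in> Y \<and> adj G x y} + 1"
proof -
  define edg where "edg A = {(x, y). x \<in> A \<inter> X \<and> y \<in> A \<inter> Y \<and> adj G x y}" for A
  define good where "good A \<longleftrightarrow> A \<subseteq> C \<and> A \<noteq> {} \<and> card A \<le> card (edg A) + 1" for A
  obtain c where "c \<in> C" using assms(2) by (auto simp: connected_set_def)
  then have "good {c}" by (simp add: good_def)
  moreover have "card A \<le> card C" if "good A" for A
    using that assms(1) by (auto simp: good_def intro: card_mono)
  ultimately obtain A where A: "good A" and max: "\<And>B. good B \<Longrightarrow> card B \<le> card A"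
    using ex_has_greatest_nat[of good "{c}" card "Suc (card C)"] less_Suc_eq_le by blast
  have "A \<subseteq> C" and "finite A"
    using A assms(1) by (auto simp: good_def dest: finite_subset)
  have "adj_closed G C A"
    unfolding adj_closed_def
  proof (intro conjI ballI impI)
    fix a b assume ab: "a \<in> A" "b \<in> C" "adj G a b"
    show "b \<in> A"
    proof (rule ccontr)
      assume "b \<notin> A"
      have "\<exists>e \<in> {(a, b), (b, a)}. e \<in> edg (insert b A)"
      proof (cases "a \<in> X")
        case True
        then have "b \<in> Y" using ab assms by (auto simp: stable_set_def)
        with True ab show ?thesis by (simp add: edg_def)
      next
        case False
        then have "a \<in> Y" using ab \<open>A \<subseteq> C\<close> assms by blast
        then have "b \<in> X" using ab assms by (auto simp: stable_set_def)
        with \<open>a \<in> Y\<close> ab show ?thesis by (simp add: edg_def adj_commute)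
      qed
      then obtain e where e: "e \<in> edg (insert b A)" "e \<notin> edg A"
        using \<open>b \<notin> A\<close> by (auto simp: edg_def)
      have "edg (insert b A) \<subseteq> C \<times> C"
        using assms(3) by (auto simp: edg_def)
      then have "finite (edg (insert b A))"
        using assms(1) by (meson finite_SigmaI finite_subset)
      moreover have "edg A \<subset> edg (insert b A)"
        using e by (auto simp: edg_def)
      ultimately have "card (edg A) < card (edg (insert b A))"
        by (rule psubset_card_mono)
      then have "good (insert b A)"
        using A ab \<open>b \<notin> A\<close> \<open>finite A\<close> by (simp add: good_def)
      with max[of "insert b A"] \<open>b \<notin> A\<close> \<open>finite A\<close> show False by simp
    qed
  qed (rule \<open>A \<subseteq> C\<close>)
  then have "A = C"
    using assms(2) A unfolding connected_set_def good_def by blast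
  moreover have "edg C = {(x, y). x \<in> X \<and> y \<in> Y \<and> adj G x y}"
    using assms(3) by (auto simp: edg_def)
  ultimately show ?thesis
    using A by (simp add: good_def)
qed

lemma card_pairs_le:
  assumes "finite X" "finite Y" "\<And>x. x \<in> X \<Longrightarrow> card {y \<in> Y. R x y} \<le> d"
  shows "card {(x, y). x \<in> X \<and> y \<in> Y \<and> R x y} \<le> d * card X"
proof -
  have "{(x, y). x \<in> X \<and> y \<in> Y \<and> R x y} = (SIGMA x:X. {y \<in> Y. R x y})"
    by auto
  then have "card {(x, y). x \<in> X \<and> y \<in> Y \<and> R x y} = (\<Sum>x\<in>X. card {y \<in> Y. R x y})"
    using assms(1,2) by (simp add: card_SigmaI)
  also have "\<dots> \<le> of_nat (card X) * d"
    by (rule sum_bounded_above) (rule assms(3))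
  finally show ?thesis by (simp add: mult.commute)
qed

text \<open>Every vertex of \<open>X\<close> has at most two neighbours in the stable set \<open>C - X\<close>, so there are at
  most \<open>2 * card X\<close> edges, while connectedness requires \<open>card X + card (C - X) - 1\<close> of them.\<close>

lemma connected_bipartition_balanced:
  assumes G: "sgraph G" "claw_free G" and C: "connected_set G C" and X: "X \<in> bipartitions G C"
  shows "card (C - X) \<le> card X + 1"
proof -
  have st: "stable_set G X" "stable_set G (C - X)" "X \<subseteq> C"
    using X by (auto simp: bipartitions_def)
  have "finite (verts G)" using G by (simp add: sgraph_def)
  then have fin: "finite X" "finite (C - X)"
    using st by (auto simp: stable_set_def dest: finite_subset)
  then have "finite C" using finite_Diff2 by blast
  have "card C \<le> card {(x, y). x \<in> X \<and> y \<in> C - X \<and> adj G x y} + 1"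
    by (rule connected_set_card_edges) (use st C \<open>finite C\<close> in auto)
  also have "\<dots> \<le> 2 * card X + 1"
    using card_pairs_le[OF fin, of "adj G" 2] claw_free_nbhd_stable[OF G st(2)] by simp
  finally show ?thesis
    using st(3) fin(1) by (simp add: card_Diff_subset)
qed

text \<open>A second bipartition agrees with the first on a set that is closed under adjacency, because
  both change sides along every edge; connectedness leaves only full agreement and full
  disagreement.\<close>

lemma bipartitions_connected:
  assumes "connected_set G C" "X \<in> bipartitions G C"
  shows "bipartitions G C = {X, C - X}"
proof -
  have "Y = X \<or> Y = C - X" if Y: "Y \<in> bipartitions G C" for Y
  proof -
    let ?A = "{v \<in> C. v \<in> X \<longleftrightarrow> v \<in> Y}"
    have "adj_closed G C ?A"
      using assms(2) Y unfolding adj_closed_def bipartitions_def stable_set_def by blast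
    then have "?A = {} \<or> ?A = C"
      using assms(1) unfolding connected_set_def by blast
    moreover have "X \<subseteq> C" "Y \<subseteq> C"
      using assms(2) Y by (auto simp: bipartitions_def)
    ultimately show ?thesis by blast
  qed
  moreover have "C - X \<in> bipartitions G C"
    using assms(2) by (auto simp: bipartitions_def double_diff)
  ultimately show ?thesis using assms(2) by blast
qed

text \<open>The two bipartitions of a connected set have first parts of sizes \<open>s, s\<close> or \<open>s, s + 1\<close>. These
  are the factors from which the generating functions of all vertex sets are built.\<close>

lemma bipartition_gf_connected:
  assumes G: "sgraph G" "claw_free G" and C: "connected_set G C" and "X \<in> bipartitions G C"
  obtains s where "bipartition_gf G C = monom 2 s" "card C = 2 * s"
  | s where "bipartition_gf G C = monom 1 s * (1 + monom 1 1)" "card C = 2 * s + 1"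
proof -
  have X: "X \<subseteq> C" "C - X \<in> bipartitions G C"
    using assms(4) by (auto simp: bipartitions_def double_diff)
  have "finite (verts G)" using G by (simp add: sgraph_def)
  then have "finite C"
    using assms(4) finite_subset[of X] finite_subset[of "C - X"]
    by (auto simp: bipartitions_def stable_set_def)
  have card: "card C = card X + card (C - X)"
    using X(1) \<open>finite C\<close> by (metis card_Diff_subset card_mono finite_subset le_add_diff_inverse)
  have "X \<noteq> C - X"
    using C X(1) by (auto simp: connected_set_def)
  then have gf: "bipartition_gf G C = monom 1 (card X) + monom 1 (card (C - X))"
    by (simp add: bipartition_gf_def bipartitions_connected[OF C assms(4)])
  have "card (C - X) \<le> card X + 1" "card X \<le> card (C - X) + 1"
    using connected_bipartition_balanced[OF G C assms(4)]
      connected_bipartition_balanced[OF G C X(2)] X(1) by (simp_all add: double_diff)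
  then consider "card X = card (C - X)" | "card (C - X) = card X + 1" | "card X = card (C - X) + 1"
    by linarith
  then show thesis
  proof cases
    case 1
    with gf card show ?thesis by (intro that(1)[of "card X"]) (simp_all add: add_monom)
  next
    case 2
    with gf card show ?thesis
      by (intro that(2)[of "card X"]) (simp_all add: distrib_left mult_monom)
  next
    case 3
    with gf card show ?thesis
      by (intro that(2)[of "card (C - X)"]) (simp_all add: distrib_left mult_monom)
  qed
qed

lemma bipartition_gf_component:
  assumes "finite D" "adj_closed G D C"
  shows "bipartition_gf G D = bipartition_gf G C * bipartition_gf G (D - C)"
proof -
  have nadj: "\<not> adj G x y" "\<not> adj G y x" if "x \<in> C" "y \<in> D - C" for x y
    using assms(2) that adj_commute[of G x y] by (auto simp: adj_closed_def)
  have "C \<subseteq> D" using assms(2) by (simp add: adj_closed_def)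
  have stable: "stable_set G S \<longleftrightarrow> stable_set G (S \<inter> C) \<and> stable_set G (S - C)" if "S \<subseteq> D" for S
    using that nadj unfolding stable_set_def by blast
  have "bipartition_gf G C * bipartition_gf G (D - C) =
      (\<Sum>(X, Y)\<in>bipartitions G C \<times> bipartitions G (D - C). monom 1 (card X) * monom 1 (card Y))"
    by (simp add: bipartition_gf_def sum_product sum.cartesian_product)
  also have "\<dots> = bipartition_gf G D"
    unfolding bipartition_gf_def
  proof (rule sum.reindex_bij_witness[where j = "\<lambda>(X, Y). X \<union> Y" and i = "\<lambda>Z. (Z \<inter> C, Z - C)"])
    fix p assume p: "p \<in> bipartitions G C \<times> bipartitions G (D - C)"
    obtain X Y where [simp]: "p = (X, Y)" by (cases p)
    have sub: "X \<subseteq> C" "Y \<subseteq> D - C" using p by (auto simp: bipartitions_def)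
    then have disj: "X \<inter> Y = {}" by blast
    have fin: "finite X" "finite Y"
      using sub \<open>C \<subseteq> D\<close> assms(1) by (meson finite_Diff finite_subset)+
    have parts: "(X \<union> Y) \<inter> C = X" "(X \<union> Y) - C = Y"
      "(D - (X \<union> Y)) \<inter> C = C - X" "(D - (X \<union> Y)) - C = (D - C) - Y"
      using sub \<open>C \<subseteq> D\<close> by blast+
    have "X \<union> Y \<subseteq> D" using sub \<open>C \<subseteq> D\<close> by blast
    then show "(case p of (X, Y) \<Rightarrow> X \<union> Y) \<in> bipartitions G D"
      using p stable[of "X \<union> Y"] stable[of "D - (X \<union> Y)"] unfolding parts
      by (simp add: bipartitions_def)
    show "((case p of (X, Y) \<Rightarrow> X \<union> Y) \<inter> C, (case p of (X, Y) \<Rightarrow> X \<union> Y) - C) = p"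
      using parts by simp
    show "monom 1 (card (case p of (X, Y) \<Rightarrow> X \<union> Y)) =
        ((case p of (X, Y) \<Rightarrow> monom 1 (card X) * monom 1 (card Y)) :: real poly)"
      using card_Un_disjoint[OF fin disj] by (simp add: mult_monom)
  next
    fix Z assume Z: "Z \<in> bipartitions G D"
    have parts: "(D - Z) \<inter> C = C - Z \<inter> C" "(D - Z) - C = (D - C) - (Z - C)"
      using \<open>C \<subseteq> D\<close> by blast+
    show "(Z \<inter> C, Z - C) \<in> bipartitions G C \<times> bipartitions G (D - C)"
      using Z stable[of Z] stable[of "D - Z"] unfolding parts
      by (auto simp: bipartitions_def)
    show "(case (Z \<inter> C, Z - C) of (X, Y) \<Rightarrow> X \<union> Y) = Z" by auto
  qed
  finally show ?thesis by simp
qed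

text \<open>Multiplying over the components, those with an even number of vertices contribute a factor
  \<open>2 x\<^sup>t\<close> and those with an odd number a factor \<open>x\<^sup>t (1 + x)\<close>. The exponent \<open>m\<close> is the number of odd
  components, and the relation with \<open>card D\<close> says that the polynomial is symmetric about half of
  \<open>card D\<close>.\<close>

lemma bipartition_gf_claw_free:
  assumes G: "sgraph G" "claw_free G"
  shows "finite D \<Longrightarrow> bipartitions G D \<noteq> {} \<Longrightarrow>
    \<exists>c s m. bipartition_gf G D = monom (2 ^ c) s * (1 + monom 1 1) ^ m \<and> card D = 2 * s + m"
proof (induction D rule: finite_psubset_induct)
  case (psubset D)
  show ?case
  proof (cases "D = {}")
    case True
    then have "bipartitions G D = {{}}"
      using psubset.prems by (auto simp: bipartitions_def)
    then show ?thesis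
      using True by (intro exI[of _ 0]) (simp add: bipartition_gf_def monom_0)
  next
    case False
    then obtain C where C: "adj_closed G D C" "connected_set G C"
      using obtain_component psubset.hyps by blast
    have CD: "C \<subseteq> D" "C \<noteq> {}"
      using C by (auto simp: adj_closed_def connected_set_def)
    then have card: "card D = card C + card (D - C)"
      using psubset.hyps by (metis card_Diff_subset card_mono finite_subset le_add_diff_inverse)
    obtain Z where "Z \<in> bipartitions G D" using psubset.prems by blast
    then have Z: "Z \<inter> C \<in> bipartitions G C" "Z - C \<in> bipartitions G (D - C)"
      using CD(1) unfolding bipartitions_def stable_set_def by blast+
    then obtain c s m where rest: "bipartition_gf G (D - C) = monom (2 ^ c) s * (1 + monom 1 1) ^ m"
      "card (D - C) = 2 * s + m"
      using psubset.IH[of "D - C"] CD by blast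
    note gf = bipartition_gf_component[OF psubset.hyps C(1)]
    from G C(2) Z(1) show ?thesis
    proof (cases rule: bipartition_gf_connected)
      case (1 t)
      have "bipartition_gf G D = monom (2 ^ Suc c) (t + s) * (1 + monom 1 1) ^ m"
        unfolding gf 1 rest by (simp only: mult.assoc[symmetric] mult_monom power_Suc)
      moreover have "card D = 2 * (t + s) + m"
        using card 1 rest by simp
      ultimately show ?thesis by blast
    next
      case (2 t)
      have split: "monom (2 ^ c) (t + s) = monom 1 t * (monom (2 ^ c) s :: real poly)"
        by (simp add: mult_monom)
      have "bipartition_gf G D = monom (2 ^ c) (t + s) * (1 + monom 1 1) ^ Suc m"
        unfolding gf 2 rest split by (simp only: power_Suc mult_ac)
      moreover have "card D = 2 * (t + s) + Suc m"
        using card 2 rest by simp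
      ultimately show ?thesis by blast
    qed
  qed
qed

text \<open>Up to a shift and a constant factor, the bipartitions are counted by a row of binomial
  coefficients whose centre corresponds to parts of equal size.\<close>

lemma bipartitions_central:
  assumes G: "sgraph G" "claw_free G" and "finite D" "card D = 2 * n"
  shows "card {X \<in> bipartitions G D. card X = k} \<le> card {X \<in> bipartitions G D. card X = n}"
proof (cases "bipartitions G D = {}")
  case False
  then obtain c s m where gf: "bipartition_gf G D = monom (2 ^ c) s * (1 + monom 1 1) ^ m"
    and card: "card D = 2 * s + m"
    using bipartition_gf_claw_free[OF G \<open>finite D\<close>] by blast
  have pow: "coeff ((1 + monom 1 1) ^ m) i = real (m choose i)" for i
  proof -
    have "1 + monom 1 1 = [:1, 1 :: real:]"
      by (simp add: monom_altdef one_pCons)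
    moreover have "coeff ([:1, 1 :: real:] ^ m) i = real (m choose i)"
    proof (cases "i \<le> m")
      case True
      then show ?thesis by (simp add: coeff_linear_poly_power)
    next
      case False
      then show ?thesis by (simp add: coeff_eq_0 degree_linear_power)
    qed
    ultimately show ?thesis by simp
  qed
  have coeff: "coeff (bipartition_gf G D) i = (if i < s then 0 else 2 ^ c * real (m choose (i - s)))" for i
    by (simp add: gf coeff_monom_mult pow[unfolded One_nat_def])
  have "m div 2 = n - s" "s \<le> n"
    using card assms(4) by linarith+
  then have "coeff (bipartition_gf G D) k \<le> coeff (bipartition_gf G D) n"
    using binomial_maximum[of m "k - s"] by (simp add: coeff)
  then show ?thesis
    by (simp add: coeff_bipartition_gf \<open>finite D\<close>)
qed simp

text \<open>Pairs of stable sets with intersection \<open>C\<close> and symmetric difference \<open>D\<close> correspond to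
  bipartitions of \<open>D\<close>: to the part \<open>X\<close> belongs the pair \<open>C \<union> X\<close>, \<open>C \<union> (D - X)\<close>. One such pair
  \<open>S\<^sub>0\<close>, \<open>T\<^sub>0\<close> must exist, because it guarantees that \<open>C\<close> is stable and has no edges to \<open>D\<close>; the
  sizes \<open>i\<close> and \<open>j\<close> may differ from those of \<open>S\<^sub>0\<close> and \<open>T\<^sub>0\<close>.\<close>

lemma card_stable_pairs_fiber:
  assumes G: "sgraph G" and st: "stable_set G S\<^sub>0" "stable_set G T\<^sub>0"
    and C: "C = S\<^sub>0 \<inter> T\<^sub>0" and D: "D = S\<^sub>0 \<union> T\<^sub>0 - C" and ij: "i + j = card S\<^sub>0 + card T\<^sub>0"
  shows "card {(S, T). stable_set G S \<and> stable_set G T \<and> card S = i \<and> card T = j \<and>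
      S \<inter> T = C \<and> S \<union> T - S \<inter> T = D} = card {X \<in> bipartitions G D. card C + card X = i}"
    (is "card ?P = card ?B")
proof -
  have "finite (verts G)" using G by (simp add: sgraph_def)
  then have fin: "finite S\<^sub>0" "finite T\<^sub>0"
    using st by (auto simp: stable_set_def dest: finite_subset)
  have finC: "finite C" and finD: "finite D"
    using fin by (simp_all add: C D)
  have "S\<^sub>0 \<union> T\<^sub>0 = D \<union> C" "D \<inter> C = {}"
    by (auto simp: C D)
  then have "card (S\<^sub>0 \<union> T\<^sub>0) = card D + card C"
    using finC finD by (simp add: card_Un_disjoint)
  then have ij': "i + j = 2 * card C + card D"
    using ij card_Un_Int[OF fin] by (simp add: C)
  have disj: "C \<inter> D = {}" by (auto simp: D)
  have stable: "stable_set G (C \<union> X)" if "X \<subseteq> D" "stable_set G X" for X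
    using st that unfolding C D stable_set_def by blast
  have stable': "stable_set G X" if "stable_set G S" "X \<subseteq> S" for X S
    using that unfolding stable_set_def by blast
  have card_X: "card (C \<union> X) = card C + card X" if "X \<subseteq> D" for X
    using that disj finC finD by (intro card_Un_disjoint) (auto dest: finite_subset)
  have card_D: "card D = card X + card (D - X)" if "X \<subseteq> D" for X
    using that finD by (simp add: card_Diff_subset finite_subset card_mono)
  have "bij_betw (\<lambda>X. (C \<union> X, C \<union> (D - X))) ?B ?P"
  proof (rule bij_betw_byWitness[where f' = "\<lambda>(S, T). S - C"])
    show "\<forall>X\<in>?B. (case (C \<union> X, C \<union> (D - X)) of (S, T) \<Rightarrow> S - C) = X"
      using disj by (auto simp: bipartitions_def)
    show "\<forall>p\<in>?P. (\<lambda>X. (C \<union> X, C \<union> (D - X))) (case p of (S, T) \<Rightarrow> S - C) = p"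
      by auto
    show "(\<lambda>X. (C \<union> X, C \<union> (D - X))) ` ?B \<subseteq> ?P"
    proof (rule image_subsetI)
      fix X assume "X \<in> ?B"
      then have X: "X \<subseteq> D" "stable_set G X" "stable_set G (D - X)" "card C + card X = i"
        by (auto simp: bipartitions_def)
      have "card C + card (D - X) = j"
        using ij' X(4) card_D[OF X(1)] by simp
      moreover have "(C \<union> X) \<inter> (C \<union> (D - X)) = C"
        "(C \<union> X) \<union> (C \<union> (D - X)) - C = D"
        using X(1) disj by blast+
      ultimately show "(C \<union> X, C \<union> (D - X)) \<in> ?P"
        using X stable[of X] stable[of "D - X"] by (simp add: card_X)
    qed
    show "(\<lambda>(S, T). S - C) ` ?P \<subseteq> ?B"
    proof (rule image_subsetI)
      fix p assume p: "p \<in> ?P"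
      obtain S T where ST [simp]: "p = (S, T)" by (cases p)
      have p': "stable_set G S" "stable_set G T" "card S = i" "S \<inter> T = C" "S \<union> T - S \<inter> T = D"
        using p by auto
      have sub: "S - C \<subseteq> D" and "D - (S - C) \<subseteq> T" and "C \<union> (S - C) = S"
        using p'(4,5) by blast+
      then have "card C + card (S - C) = i"
        using card_X[OF sub] p'(3) by simp
      moreover have "stable_set G (S - C)" "stable_set G (D - (S - C))"
        using stable' p'(1,2) \<open>D - (S - C) \<subseteq> T\<close> by blast+
      ultimately show "(case p of (S, T) \<Rightarrow> S - C) \<in> ?B"
        using sub by (simp add: bipartitions_def)
    qed
  qed
  then show ?thesis by (simp add: bij_betw_same_card)
qed

lemma card_le_fiberwise:
  assumes "finite A" "finite B"
    and "\<And>a. a \<in> A \<Longrightarrow> card {x \<in> A. f x = f a} \<le> card {x \<in> B. f x = f a}"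
  shows "card A \<le> card B"
proof -
  have "card A = (\<Sum>z\<in>f ` A. card {x \<in> A. f x = z})"
    using sum.image_gen[OF assms(1), of "\<lambda>_. 1::nat" f] by simp
  also have "\<dots> \<le> (\<Sum>z\<in>f ` A. card {x \<in> B. f x = z})"
    by (rule sum_mono) (use assms(3) in auto)
  also have "\<dots> = card (\<Union>z\<in>f ` A. {x \<in> B. f x = z})"
    using assms(1,2) by (intro card_UN_disjoint[symmetric]) auto
  also have "\<dots> \<le> card B"
    using assms(2) by (intro card_mono) auto
  finally show ?thesis .
qed

text \<open>Hamidoune's theorem. Both sides count pairs of stable sets, of sizes \<open>k, k + 2\<close> and
  \<open>k + 1, k + 1\<close>. It suffices to compare the pairs with the same intersection and the same symmetric
  difference \<open>D\<close>, and there equal sizes amount to a bipartition of \<open>D\<close> into halves, which is the most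
  frequent kind.\<close>

theorem num_stable_log_concave:
  assumes G: "sgraph G" "claw_free G"
  shows "num_stable G k * num_stable G (Suc (Suc k)) \<le> (num_stable G (Suc k))\<^sup>2"
proof -
  define pairs where "pairs i j = {S. stable_set G S \<and> card S = i} \<times> {T. stable_set G T \<and> card T = j}" for i j
  define f :: "'a set \<times> 'a set \<Rightarrow> 'a set \<times> 'a set" where "f = (\<lambda>(S, T). (S \<inter> T, S \<union> T - S \<inter> T))"
  have "finite (verts G)" using G by (simp add: sgraph_def)
  then have fin: "finite (pairs i j)" for i j
    by (simp add: pairs_def finite_stable_sets)
  have "card (pairs k (Suc (Suc k))) \<le> card (pairs (Suc k) (Suc k))"
  proof (rule card_le_fiberwise[OF fin fin, where f = f])
    fix p assume p: "p \<in> pairs k (Suc (Suc k))"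
    obtain S T where ST: "p = (S, T)" by (cases p)
    define C where "C = S \<inter> T"
    define D where "D = S \<union> T - C"
    have st: "stable_set G S" "stable_set G T" and card: "card S = k" "card T = Suc (Suc k)"
      using p by (auto simp: pairs_def ST)
    have finST: "finite S" "finite T"
      using st \<open>finite (verts G)\<close> by (auto simp: stable_set_def dest: finite_subset)
    have "card C \<le> k"
      using card finST by (auto simp: C_def intro: card_mono)
    have "S \<union> T = D \<union> C" "D \<inter> C = {}" "finite C" "finite D"
      using finST by (auto simp: C_def D_def)
    then have "card (S \<union> T) = card D + card C"
      by (simp add: card_Un_disjoint)
    then have card_D: "card D = 2 * (Suc k - card C)"
      using card_Un_Int[OF finST] card \<open>card C \<le> k\<close> by (simp add: C_def)
    have fiber: "card {q \<in> pairs i j. f q = f p} = card {X \<in> bipartitions G D. card C + card X = i}"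
      if "i + j = Suc k + Suc k" for i j
    proof -
      have "{q \<in> pairs i j. f q = f p} = {(S, T). stable_set G S \<and> stable_set G T \<and> card S = i \<and>
          card T = j \<and> S \<inter> T = C \<and> S \<union> T - S \<inter> T = D}"
        by (auto simp: pairs_def f_def ST C_def D_def)
      then show ?thesis
        using card_stable_pairs_fiber[OF G(1) st C_def D_def, of i j] that card by simp
    qed
    have "{X \<in> bipartitions G D. card C + card X = k} = {X \<in> bipartitions G D. card X = k - card C}"
      "{X \<in> bipartitions G D. card C + card X = Suc k} = {X \<in> bipartitions G D. card X = Suc k - card C}"
      using \<open>card C \<le> k\<close> by auto
    moreover have "finite D" using finST by (simp add: D_def)
    ultimately show "card {q \<in> pairs k (Suc (Suc k)). f q = f p} \<le> card {q \<in> pairs (Suc k) (Suc k). f q = f p}"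
      using bipartitions_central[OF G _ card_D, of "k - card C"] by (simp add: fiber)
  qed
  then show ?thesis
    by (simp add: pairs_def num_stable_def power2_eq_square card_cartesian_product)
qed

text \<open>Log-concavity says that the ratio of successive coefficients is nonincreasing as long as no
  coefficient vanishes, so after the first descent the sequence never rises again.\<close>

lemma unimodal_if_log_concave:
  assumes pos: "\<And>i. i \<le> degree p \<Longrightarrow> 0 < coeff p i"
    and log_concave: "\<And>i. coeff p i * coeff p (Suc (Suc i)) \<le> (coeff p (Suc i))\<^sup>2"
  shows "unimodal p"
proof -
  define k where "k = (LEAST k. k = degree p \<or> coeff p (Suc k) < coeff p k)"
  have "k = degree p \<or> coeff p (Suc k) < coeff p k"
    unfolding k_def by (rule LeastI[of _ "degree p"]) simp
  moreover have "k \<le> degree p"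
    unfolding k_def by (rule Least_le) simp
  moreover have up: "coeff p i \<le> coeff p (Suc i)" if "i < k" for i
    using not_less_Least[OF that[unfolded k_def]] by auto
  moreover have "coeff p (Suc i) \<le> coeff p i"
    if "coeff p (Suc k) < coeff p k" "k \<le> i" "i < degree p" for i
    using that(2,3)
  proof (induction i rule: dec_induct)
    case base
    then show ?case using that(1) by simp
  next
    case (step i)
    then have IH: "coeff p (Suc i) \<le> coeff p i" and "0 < coeff p i" "0 < coeff p (Suc i)"
      using pos by auto
    have "coeff p i * coeff p (Suc (Suc i)) \<le> coeff p (Suc i) * coeff p (Suc i)"
      using log_concave[of i] by (simp add: power2_eq_square)
    also have "\<dots> \<le> coeff p i * coeff p (Suc i)"
      using IH \<open>0 < coeff p (Suc i)\<close> by (simp add: mult_right_mono)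
    finally show ?case using \<open>0 < coeff p i\<close> by simp
  qed
  moreover have "0 \<le> coeff p i" for i
    using pos[of i] coeff_eq_0[of p i] by (cases "i \<le> degree p") auto
  ultimately show ?thesis
    unfolding unimodal_def by (auto intro!: exI[of _ k])
qed

text \<open>Subsets of stable sets are stable, so no coefficient up to the degree vanishes.\<close>

theorem claw_free_unimodal:
  assumes G: "sgraph G" "claw_free G"
  shows "unimodal (indep_poly G)"
proof (rule unimodal_if_log_concave)
  have fin: "finite (verts G)" using G by (simp add: sgraph_def)
  note coeff = coeff_indep_poly[OF fin]
  have pos: "0 < num_stable G i" if "stable_set G S" "i \<le> card S" for S i
  proof -
    obtain T where "T \<subseteq> S" "card T = i"
      using obtain_subset_with_card_n[OF \<open>i \<le> card S\<close>] by blast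
    then have "T \<in> {S. stable_set G S \<and> card S = i}"
      using that(1) by (auto simp: stable_set_def)
    moreover have "finite {S. stable_set G S \<and> card S = i}"
      by (rule finite_stable_sets[OF fin])
    ultimately show ?thesis
      unfolding num_stable_def card_gt_0_iff by (metis empty_iff)
  qed
  have "coeff (indep_poly G) 0 \<noteq> 0"
    using pos[of "{}" 0] by (simp add: coeff stable_set_def)
  then have "coeff (indep_poly G) (degree (indep_poly G)) \<noteq> 0"
    by auto
  then have "num_stable G (degree (indep_poly G)) \<noteq> 0"
    by (simp add: coeff)
  then have "{S. stable_set G S \<and> card S = degree (indep_poly G)} \<noteq> {}"
    unfolding num_stable_def by (metis card.empty)
  then obtain S where "stable_set G S" "card S = degree (indep_poly G)"
    by blast
  then show "0 < coeff (indep_poly G) i" if "i \<le> degree (indep_poly G)" for i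
    using pos that by (simp add: coeff)
  show "coeff (indep_poly G) i * coeff (indep_poly G) (Suc (Suc i)) \<le> (coeff (indep_poly G) (Suc i))\<^sup>2" for i
    using num_stable_log_concave[OF G, of i] unfolding coeff by (simp flip: of_nat_mult of_nat_power)
qed

section \<open>The tree and its replacement\<close>

lemma vimage_insert_sum [simp]:
  "Inl -` insert (Inl a) U = insert a (Inl -` U)"
  "Inl -` insert (Inr b) U = Inl -` U"
  "Inr -` insert (Inr b) U = insert b (Inr -` U)"
  "Inr -` insert (Inl a) U = Inr -` U"
  by auto

lemma verts_edge_join [simp]: "verts (edge_join G v H w) = Inl ` verts G \<union> Inr ` verts H"
  by (simp add: edge_join_def)

lemma stable_gf_edge_join:
  assumes "finite (verts G)" "finite (verts H)"
  shows "stable_gf (edge_join G v H w) U =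
    stable_gf G (Inl -` U) * stable_gf H (Inr -` U) -
    stable_gf G (insert v (Inl -` U)) * stable_gf H (insert w (Inr -` U))"
  using assms by (simp add: edge_join_def stable_gf_add_edge stable_gf_disj_union)

text \<open>The twelve vertices form six disjoint edges, a perfect matching of the tree, and the remaining
  five edges connect these in a tree-like way. So \<open>G24\<close> is an iterated edge-join of copies of \<open>K\<^sub>2\<close>,
  and \<open>stable_gf_edge_join\<close> computes its generating functions.\<close>

primrec K2_tree_vertex :: "g24_vertex \<Rightarrow> (nat + nat) + ((nat + nat) + (nat + nat))" where
  "K2_tree_vertex a1 = Inl (Inl 0)"
| "K2_tree_vertex b1 = Inl (Inl 1)"
| "K2_tree_vertex a2 = Inl (Inr 0)"
| "K2_tree_vertex b2 = Inl (Inr 1)"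
| "K2_tree_vertex u1 = Inr (Inl (Inl 0))"
| "K2_tree_vertex v1 = Inr (Inl (Inl 1))"
| "K2_tree_vertex u2 = Inr (Inl (Inr 0))"
| "K2_tree_vertex v2 = Inr (Inl (Inr 1))"
| "K2_tree_vertex u3 = Inr (Inr (Inl 0))"
| "K2_tree_vertex v3 = Inr (Inr (Inl 1))"
| "K2_tree_vertex u4 = Inr (Inr (Inr 0))"
| "K2_tree_vertex v4 = Inr (Inr (Inr 1))"

lemma stable_gf_G24_K2_tree:
  "stable_gf G24 U = stable_gf
     (edge_join (edge_join (K 2) 1 (K 2) 1) (Inr 1)
       (edge_join (edge_join (K 2) 1 (K 2) 1) (Inr 1) (edge_join (K 2) 1 (K 2) 1) (Inl 1))
       (Inl (Inr 1)))
     (K2_tree_vertex ` U)"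
    (is "_ = stable_gf ?T _")
proof (rule stable_gf_iso)
  have lt: "{..<2} = {0, 1 :: nat}" by auto
  have UNIV: "UNIV = {a1, a2, b1, b2, u1, u2, u3, u4, v1, v2, v3, v4}"
    by (auto intro: g24_vertex.exhaust)
  have adj_G24: "adj G24 x y \<longleftrightarrow> {x, y} \<in> {{a1, b1}, {a2, b2}, {b1, b2},
      {u1, v1}, {u2, v2}, {u3, v3}, {u4, v4}, {v1, v2}, {v2, v3}, {v3, v4}, {b2, v2}}" for x y
    by (simp add: adj_def G24_def)
  show "bij_betw K2_tree_vertex (verts G24) (verts ?T)"
    by (simp add: bij_betw_def inj_on_def G24_def UNIV lt insert_commute)
  show "adj ?T (K2_tree_vertex x) (K2_tree_vertex y) \<longleftrightarrow> adj G24 x y" for x y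
    by (cases x; cases y; simp add: edge_join_def adj_add_edge doubleton_eq_iff adj_G24)
  show "U \<subseteq> verts G24" by (simp add: G24_def)
qed

lemma finite_verts_G24: "finite (verts G24)"
proof (rule finite_subset)
  show "verts G24 \<subseteq> {a1, a2, b1, b2, u1, u2, u3, u4, v1, v2, v3, v4}"
    by (auto intro: g24_vertex.exhaust)
qed simp

lemma stable_gf_G24:
  defines "x \<equiv> monom (1::real) 1"
  defines "c \<equiv> (1 + x) ^ 3 * (1 + 2 * x)"
  shows "stable_gf G24 {} = c * ((1 + 4 * x) * (1 + 3 * x) - x * x)"
    and "stable_gf G24 {v4} = c * ((1 + 4 * x) * x)"
    and "stable_gf G24 {b2} = c * (x * (1 + 3 * x))"
    and "stable_gf G24 {v4, b2} = c * (x * x)"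
  unfolding c_def
  by (simp_all add: stable_gf_G24_K2_tree stable_gf_edge_join stable_gf_K flip: x_def[unfolded One_nat_def])
     algebra+

lemma stable_gf_K4_K3:
  assumes "p < 4" "q < 3" "u < 4" "v < 3"
  defines "x \<equiv> monom (1::real) 1"
  shows "stable_gf (edge_join (K 4) p (K 3) q) {} = (1 + 4 * x) * (1 + 3 * x) - x * x"
    and "v \<noteq> q \<Longrightarrow> stable_gf (edge_join (K 4) p (K 3) q) {Inr v} = (1 + 4 * x) * x"
    and "u \<noteq> p \<Longrightarrow> stable_gf (edge_join (K 4) p (K 3) q) {Inl u} = x * (1 + 3 * x)"
    and "u \<noteq> p \<Longrightarrow> v \<noteq> q \<Longrightarrow> stable_gf (edge_join (K 4) p (K 3) q) {Inr v, Inl u} = x * x"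
  using assms(1-4) by (simp_all add: stable_gf_edge_join stable_gf_K x_def)

lemma stable_gf_pad:
  defines "x \<equiv> monom (1::real) 1"
  assumes "finite (verts L)"
  shows "stable_gf (copies 3 (K 1) \<amalg> K 2 \<amalg> L) {} = (1 + x) ^ 3 * (1 + 2 * x) * stable_gf L {}"
proof -
  have "stable_gf (copies 3 (K 1)) {} = (1 + x) ^ 3"
    using stable_gf_edgeless[OF edges_copies_K1[of 3]] by (simp add: x_def)
  then show ?thesis
    using assms(2) by (simp add: stable_gf_disj_union stable_gf_K x_def)
qed

lemma stable_gf_two_sided_join:
  assumes "finite (verts H\<^sub>1)" "finite (verts G)" "finite (verts H\<^sub>2)"
  shows "stable_gf (add_edge (add_edge (H\<^sub>1 \<amalg> G \<amalg> H\<^sub>2)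
        (Inl w\<^sub>1) (Inr (Inl v))) (Inr (Inl u)) (Inr (Inr w\<^sub>2))) {} =
    stable_gf H\<^sub>1 {} * stable_gf G {} * stable_gf H\<^sub>2 {}
    - stable_gf H\<^sub>1 {w\<^sub>1} * stable_gf G {v} * stable_gf H\<^sub>2 {}
    - stable_gf H\<^sub>1 {} * stable_gf G {u} * stable_gf H\<^sub>2 {w\<^sub>2}
    + stable_gf H\<^sub>1 {w\<^sub>1} * stable_gf G {v, u} * stable_gf H\<^sub>2 {w\<^sub>2}"
  using assms by (simp add: stable_gf_add_edge stable_gf_disj_union mult.assoc)

text \<open>Here \<open>c\<close> is the contribution of the summand \<open>3K\<^sub>1 \<amalg> K\<^sub>2\<close>.\<close>

lemma stable_gf_G24_K4_K3:
  defines "c \<equiv> (1 + monom (1::real) 1) ^ 3 * (1 + 2 * monom 1 1)"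
  assumes "p < 4" "q < 3" "u < 4" "v < 3"
  shows "stable_gf G24 {} = c * stable_gf (edge_join (K 4) p (K 3) q) {}"
    and "v \<noteq> q \<Longrightarrow> stable_gf G24 {v4} = c * stable_gf (edge_join (K 4) p (K 3) q) {Inr v}"
    and "u \<noteq> p \<Longrightarrow> stable_gf G24 {b2} = c * stable_gf (edge_join (K 4) p (K 3) q) {Inl u}"
    and "u \<noteq> p \<Longrightarrow> v \<noteq> q \<Longrightarrow>
      stable_gf G24 {v4, b2} = c * stable_gf (edge_join (K 4) p (K 3) q) {Inr v, Inl u}"
  using stable_gf_K4_K3[OF assms(2-5)] unfolding c_def stable_gf_G24 by simp_all

lemma indep_poly_pad:
  assumes "finite (verts L)"
  shows "indep_poly (copies 3 (K 1) \<amalg> K 2 \<amalg> L) =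
    (1 + monom 1 1) ^ 3 * (1 + 2 * monom 1 1) * stable_gf L {}"
  using assms indep_poly_eq_stable_gf[of "copies 3 (K 1) \<amalg> K 2 \<amalg> L"] stable_gf_pad[of L] by simp

lemma finite_verts_K4_K3: "finite (verts (edge_join (K 4) p (K 3) q))"
  by simp

lemma indep_poly_G24:
  assumes "p < 4" "q < 3"
  shows "indep_poly G24 = indep_poly (copies 3 (K 1) \<amalg> K 2 \<amalg> edge_join (K 4) p (K 3) q)"
  unfolding indep_poly_pad[OF finite_verts_K4_K3] indep_poly_eq_stable_gf[OF finite_verts_G24]
  by (rule stable_gf_G24_K4_K3(1)[OF assms assms])

lemma indep_poly_G24_join:
  assumes "finite (verts H)" "p < 4" "q < 3" "v < 3" "v \<noteq> q"
  shows "indep_poly (edge_join G24 v4 H w) =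
    indep_poly (copies 3 (K 1) \<amalg> K 2 \<amalg> edge_join (edge_join (K 4) p (K 3) q) (Inr v) H w)"
    (is "indep_poly ?G = indep_poly (_ \<amalg> _ \<amalg> ?L)")
proof -
  have "stable_gf ?G {} = (1 + monom 1 1) ^ 3 * (1 + 2 * monom 1 1) * stable_gf ?L {}"
    using stable_gf_G24_K4_K3(1,2)[OF assms(2,3,2,4)] assms(5)
    unfolding stable_gf_edge_join[OF finite_verts_G24 assms(1)]
      stable_gf_edge_join[OF finite_verts_K4_K3 assms(1)]
    by (simp add: right_diff_distrib mult.assoc)
  moreover have "finite (verts ?G)" "finite (verts ?L)"
    using assms(1) finite_verts_G24 by simp_all
  ultimately show ?thesis
    by (simp only: indep_poly_pad indep_poly_eq_stable_gf)
qed

lemma indep_poly_G24_two_sided_join: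
  assumes "finite (verts H\<^sub>1)" "finite (verts H\<^sub>2)"
    and "p < 4" "q < 3" "u < 4" "v < 3" "u \<noteq> p" "v \<noteq> q"
  shows "indep_poly (add_edge (add_edge (H\<^sub>1 \<amalg> G24 \<amalg> H\<^sub>2)
        (Inl w\<^sub>1) (Inr (Inl v4))) (Inr (Inl b2)) (Inr (Inr w\<^sub>2))) =
      indep_poly (copies 3 (K 1) \<amalg> K 2 \<amalg> add_edge (add_edge (H\<^sub>1 \<amalg> edge_join (K 4) p (K 3) q \<amalg> H\<^sub>2)
        (Inl w\<^sub>1) (Inr (Inl (Inr v)))) (Inr (Inl (Inl u))) (Inr (Inr w\<^sub>2)))"
    (is "indep_poly ?G = indep_poly (_ \<amalg> _ \<amalg> ?L)")
proof -
  have "stable_gf ?G {} = (1 + monom 1 1) ^ 3 * (1 + 2 * monom 1 1) * stable_gf ?L {}"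
    unfolding stable_gf_two_sided_join[OF assms(1) finite_verts_G24 assms(2)]
      stable_gf_two_sided_join[OF assms(1) finite_verts_K4_K3 assms(2)]
      stable_gf_G24_K4_K3(1)[OF assms(3-6)] stable_gf_G24_K4_K3(2)[OF assms(3-6,8)]
      stable_gf_G24_K4_K3(3)[OF assms(3-7)] stable_gf_G24_K4_K3(4)[OF assms(3-8)]
    by (simp only: right_diff_distrib distrib_left mult_ac)
  moreover have "finite (verts ?G)" "finite (verts ?L)"
    using assms(1,2) finite_verts_G24 by simp_all
  ultimately show ?thesis
    by (simp only: indep_poly_pad indep_poly_eq_stable_gf)
qed

section \<open>Unimodality of the joins with the tree\<close>

text \<open>Since the independence polynomials of the joins with the tree do not depend on which vertices
  play the roles of \<open>p, q, u, v\<close>, one choice is enough for unimodality.\<close>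

lemma K4_K3_claw_free:
  shows "sgraph (edge_join (K 4) 0 (K 3) 0)" "claw_free (edge_join (K 4) 0 (K 3) 0)"
    and "simplicial (edge_join (K 4) 0 (K 3) 0) (Inr 1)"
    and "simplicial (edge_join (K 4) 0 (K 3) 0) (Inl 1)"
  unfolding edge_join_def
  by (auto intro!: sgraph_add_edge sgraph_disj_union sgraph_K claw_free_add_edge claw_free_disj_union
      claw_free_K simplicial_add_edge simp: simplicial_disj_union simplicial_K sgraph_K)

lemma pad_claw_free:
  assumes "sgraph L" "claw_free L"
  shows "sgraph (copies 3 (K 1) \<amalg> K 2 \<amalg> L)" "claw_free (copies 3 (K 1) \<amalg> K 2 \<amalg> L)"
  by (intro sgraph_disj_union claw_free_disj_union sgraph_copies_K1 claw_free_copies_K1 sgraph_K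
      claw_free_K assms)+

lemma unimodal_G24: "unimodal (indep_poly G24)"
  using indep_poly_G24[of 0 0] claw_free_unimodal[OF pad_claw_free[OF K4_K3_claw_free(1,2)]] by simp

lemma unimodal_G24_join:
  assumes "sgraph H" "simplicial H w" "claw_free H"
  shows "unimodal (indep_poly (edge_join G24 v4 H w))"
proof -
  let ?M = "edge_join (K 4) 0 (K 3) 0"
  have "finite (verts H)"
    using assms(1) by (simp add: sgraph_def)
  have "w \<in> verts H" "Inr 1 \<in> verts ?M"
    using assms(2) K4_K3_claw_free(3) unfolding simplicial_def by blast+
  then have "sgraph (edge_join ?M (Inr 1) H w)" "claw_free (edge_join ?M (Inr 1) H w)"
    unfolding edge_join_def[of ?M] using assms K4_K3_claw_free
    by (auto intro!: sgraph_add_edge sgraph_disj_union claw_free_add_edge claw_free_disj_union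
        simp: simplicial_disj_union)
  from claw_free_unimodal[OF pad_claw_free[OF this]] show ?thesis
    using indep_poly_G24_join[OF \<open>finite (verts H)\<close>, of 0 0 1 w] by simp
qed

lemma unimodal_G24_two_sided_join:
  assumes "sgraph H\<^sub>1" "sgraph H\<^sub>2" "simplicial H\<^sub>1 w\<^sub>1" "simplicial H\<^sub>2 w\<^sub>2" "claw_free H\<^sub>1" "claw_free H\<^sub>2"
  shows "unimodal (indep_poly (add_edge (add_edge (H\<^sub>1 \<amalg> G24 \<amalg> H\<^sub>2)
        (Inl w\<^sub>1) (Inr (Inl v4))) (Inr (Inl b2)) (Inr (Inr w\<^sub>2))))"
proof -
  let ?B = "H\<^sub>1 \<amalg> edge_join (K 4) 0 (K 3) 0 \<amalg> H\<^sub>2"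
  let ?C = "add_edge ?B (Inl w\<^sub>1) (Inr (Inl (Inr 1)))"
  let ?L = "add_edge ?C (Inr (Inl (Inl 1))) (Inr (Inr w\<^sub>2))"
  have fin: "finite (verts H\<^sub>1)" "finite (verts H\<^sub>2)"
    using assms(1,2) by (simp_all add: sgraph_def)
  have B: "sgraph ?B" "claw_free ?B"
    by (intro sgraph_disj_union claw_free_disj_union assms K4_K3_claw_free)+
  have simp_B: "simplicial ?B (Inl w\<^sub>1)" "simplicial ?B (Inr (Inl (Inr 1)))"
    "simplicial ?B (Inr (Inl (Inl 1)))" "simplicial ?B (Inr (Inr w\<^sub>2))"
    using assms K4_K3_claw_free by (simp_all add: simplicial_disj_union sgraph_disj_union)
  then have verts: "Inl w\<^sub>1 \<in> verts ?B" "Inr (Inl (Inr 1)) \<in> verts ?B"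
    "Inr (Inl (Inl 1)) \<in> verts ?B" "Inr (Inr w\<^sub>2) \<in> verts ?B"
    unfolding simplicial_def by blast+
  have C: "sgraph ?C" "claw_free ?C"
    using sgraph_add_edge[OF B(1) verts(1,2)] claw_free_add_edge[OF B simp_B(1,2)] by simp_all
  \<comment> \<open>The first edge misses the endpoints of the second, so these stay simplicial.\<close>
  have simp_C: "simplicial ?C (Inr (Inl (Inl 1)))" "simplicial ?C (Inr (Inr w\<^sub>2))"
    by (rule simplicial_add_edge[OF B(1)]; use simp_B verts in simp)+
  have "sgraph ?L" "claw_free ?L"
    using sgraph_add_edge[OF C(1)] verts(3,4) claw_free_add_edge[OF C simp_C] by simp_all
  from claw_free_unimodal[OF pad_claw_free[OF this]] show ?thesis
    using indep_poly_G24_two_sided_join[OF fin, of 0 0 1 1 w\<^sub>1 w\<^sub>2] by simp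
qed

theorem proposition4p4:
  shows
    "(unimodal (indep_poly G24) \<and>
      (\<forall>p\<in>verts (K 4). \<forall>q\<in>verts (K 3).
         indep_poly G24 = indep_poly (copies 3 (K 1) \<amalg> K 2 \<amalg> edge_join (K 4) p (K 3) q)))
   \<and>
     (\<forall>(H :: 'a sgraph) w. sgraph H \<and> w \<in> verts H \<longrightarrow>
        (let G = edge_join G24 v4 H w in
           (\<forall>p\<in>verts (K 4). \<forall>q\<in>verts (K 3). \<forall>v\<in>verts (K 3). v \<noteq> q \<longrightarrow>
              (let L = copies 3 (K 1) \<amalg> K 2 \<amalg>
                         edge_join (edge_join (K 4) p (K 3) q) (Inr v) H w
               in indep_poly G = indep_poly L)) \<and>
           (simplicial H w \<and> claw_free H \<longrightarrow> unimodal (indep_poly G))))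
   \<and>
     (\<forall>(H\<^sub>1 :: 'b sgraph) (H\<^sub>2 :: 'c sgraph) w\<^sub>1 w\<^sub>2.
        sgraph H\<^sub>1 \<and> sgraph H\<^sub>2 \<and> w\<^sub>1 \<in> verts H\<^sub>1 \<and> w\<^sub>2 \<in> verts H\<^sub>2 \<longrightarrow>
        (let G = add_edge (add_edge (H\<^sub>1 \<amalg> G24 \<amalg> H\<^sub>2)
                   (Inl w\<^sub>1) (Inr (Inl v4))) (Inr (Inl b2)) (Inr (Inr w\<^sub>2)) in
           (\<forall>p\<in>verts (K 4). \<forall>q\<in>verts (K 3). \<forall>u\<in>verts (K 4). \<forall>v\<in>verts (K 3).
              u \<noteq> p \<and> v \<noteq> q \<longrightarrow>
              (let L' = add_edge (add_edge (H\<^sub>1 \<amalg> edge_join (K 4) p (K 3) q \<amalg> H\<^sub>2)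
                          (Inl w\<^sub>1) (Inr (Inl (Inr v)))) (Inr (Inl (Inl u))) (Inr (Inr w\<^sub>2));
                   L = copies 3 (K 1) \<amalg> K 2 \<amalg> L'
               in indep_poly G = indep_poly L)) \<and>
           (simplicial H\<^sub>1 w\<^sub>1 \<and> simplicial H\<^sub>2 w\<^sub>2 \<and> claw_free H\<^sub>1 \<and> claw_free H\<^sub>2 \<longrightarrow>
              unimodal (indep_poly G))))"
proof -
  have finite: "finite (verts H)" if "sgraph H" for H :: "'x sgraph"
    using that by (simp add: sgraph_def)
  show ?thesis
    unfolding Let_def verts_simps Ball_def lessThan_iff
    by (intro conjI allI impI; (elim conjE)?;
        intro unimodal_G24 indep_poly_G24 indep_poly_G24_join unimodal_G24_join
          indep_poly_G24_two_sided_join unimodal_G24_two_sided_join finite; assumption)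
qed

end
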